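(* Let $E$ be a finite set, let $X \subseteq \mathbb{R}^E$ be a non-empty convex set, let $\mathcal{C}$ be the set of all convex cost functions $c\colon X\to\mathbb{R}$, and let $S \subseteq E$. Let $\{x_0,\dots,x_k\}\subseteq X$ be an affine basis of $X$ (an inclusion-wise maximal affinely independent subset of $X$), and for $F \subseteq E$ let $A(F) := \{x_i - x_0 : i \in \{1,\dots,k\}\} \cup \{\chi_e : e \in F\}$, where $\chi_e$ is the unit vector of $e$. Let $\mathcal{A}_X := \{F \subseteq E : A(F) \text{ is linearly independent}\}$. Then the following are equivalent: (i) $S$ is controlling for $(X,\mathcal{C})$; (ii) $S$ is identifying for $X$; (iii) $E \setminus S \in \mathcal{A}_X$.
   Context: A set $S \subseteq E$ is controlling for $(X,\mathcal{C})$ if for every $c \in \mathcal{C}$ and every $x^* \in X$ there is $\gamma \in \mathbb{R}^S$ such that the minimum $\min_{x \in X}\{c(x) + \sum_{e\in S}\gamma_e x_e\}$ exists and is attained at $x^*$. A set $S \subseteq E$ is identifying for $X$ if for all $x, x' \in X$ with $x \neq x'$ there is $e \in S$ with $x_e \neq x'_e$.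
   Formalization: The cost functions are the restrictions to X of convex functions on an open convex set containing X (for all convex c the claim fails: X=[0,1], c=−√x, x*=0), and A(F) is an indexed family, so a vector x_i − x_0 equal to some χ_e makes it dependent; E is non-empty. *)

theory Defs
  imports "HOL-Analysis.Analysis"
begin

text \<open>
  The ground set is a finite type \<open>'e\<close>, so that \<open>real ^ 'e\<close> is the space of real vectors indexed
  by it. Cost functions on a set \<open>X\<close> are total functions of which only the values on \<open>X\<close> matter,
  and likewise only the values of \<open>\<gamma>\<close> on \<open>S\<close> matter.
\<close>

definition controlling ::
    "'e::finite set \<Rightarrow> (real ^ 'e) set \<Rightarrow> (real ^ 'e \<Rightarrow> real) set \<Rightarrow> bool" where
  "controlling S X C \<longleftrightarrow>
     (\<forall>c\<in>C. \<forall>x'\<in>X. \<exists>\<gamma> :: 'e \<Rightarrow> real.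
        is_arg_min (\<lambda>x. c x + (\<Sum>e\<in>S. \<gamma> e * x $ e)) (\<lambda>x. x \<in> X) x')"

definition identifying :: "'e::finite set \<Rightarrow> (real ^ 'e) set \<Rightarrow> bool" where
  "identifying S X \<longleftrightarrow> (\<forall>x\<in>X. \<forall>x'\<in>X. x \<noteq> x' \<longrightarrow> (\<exists>e\<in>S. x $ e \<noteq> x' $ e))"

text \<open>
  A convex cost function on \<open>X\<close> is the restriction to \<open>X\<close> of a finite convex function on an open
  convex set containing \<open>X\<close>. If \<open>X\<close> is relatively open, these are all functions that are convex
  on \<open>X\<close>. Otherwise convexity on \<open>X\<close> alone would admit functions without a subgradient at a
  relative boundary point, such as \<open>- sqrt x\<close> on \<open>[0, 1]\<close>; no choice of \<open>\<gamma>\<close> makes \<open>0\<close> a minimiser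
  of \<open>- sqrt x + \<gamma> * x\<close> on \<open>[0, 1]\<close>, although the whole ground set is identifying.
\<close>

definition convex_costs :: "(real ^ 'e::finite) set \<Rightarrow> (real ^ 'e \<Rightarrow> real) set" where
  "convex_costs X =
     {c. \<exists>U f. open U \<and> X \<subseteq> U \<and> convex_on U f \<and> (\<forall>x\<in>X. c x = f x)}"

definition affine_basis_of :: "(real ^ 'e::finite) set \<Rightarrow> (real ^ 'e) set \<Rightarrow> bool" where
  "affine_basis_of B X \<longleftrightarrow>
     B \<subseteq> X \<and> \<not> affine_dependent B \<and>
     (\<forall>B'. B \<subseteq> B' \<and> B' \<subseteq> X \<and> \<not> affine_dependent B' \<longrightarrow> B' = B)"

definition independent_family :: "('i \<Rightarrow> 'v::real_vector) \<Rightarrow> 'i set \<Rightarrow> bool" where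
  "independent_family v I \<longleftrightarrow> inj_on v I \<and> independent (v ` I)"

text \<open>
  The difference vectors together with the unit vectors form an indexed family, not a set: if
  some difference equals the unit vector of some \<open>e \<in> F\<close>, the vector is repeated and the family
  is dependent.
\<close>

definition A_vec :: "(nat \<Rightarrow> real ^ 'e::finite) \<Rightarrow> nat + 'e \<Rightarrow> real ^ 'e" where
  "A_vec x = case_sum (\<lambda>i. x i - x 0) (\<lambda>e. axis e 1)"

definition A_index :: "nat \<Rightarrow> 'e set \<Rightarrow> (nat + 'e) set" where
  "A_index k F = {1..k} <+> F"

definition A_indep :: "(nat \<Rightarrow> real ^ 'e::finite) \<Rightarrow> nat \<Rightarrow> 'e set set" where
  "A_indep x k = {F. independent_family (A_vec x) (A_index k F)}"

end

theory Submission
  imports Defs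
begin

text \<open>
  Let \<open>V\<close> be the direction space of the affine hull of \<open>X\<close>. All three conditions say that no
  non-zero vector of \<open>V\<close> vanishes on \<open>S\<close>. For identification, scale such a vector down and add it
  to a relative interior point of \<open>X\<close>. For independence, the vectors vanishing on \<open>S\<close> are those
  spanned by the unit vectors outside \<open>S\<close>. If two points of \<open>X\<close> agree on \<open>S\<close>, then a linear cost
  separating them shows that \<open>S\<close> is not controlling; conversely, if the coordinates in \<open>S\<close>
  determine the vectors of \<open>V\<close>, then every subgradient of the cost agrees on \<open>V\<close> with a functional
  supported on \<open>S\<close>.
\<close>

text \<open>The open vertical ray below \<open>(p, f p)\<close> is separated from the epigraph by a
  hyperplane with normal \<open>(a, r)\<close>. Once \<open>r > 0\<close> is known, dividing by
  \<open>r\<close> gives the subgradient \<open>- (a /\<^sub>R r)\<close>.\<close>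

lemma convex_on_open_subgradient:
  fixes f :: "'a::euclidean_space \<Rightarrow> real"
  assumes "open U" and "convex_on U f" and "p \<in> U"
  obtains g where "\<And>y. y \<in> U \<Longrightarrow> f p + g \<bullet> (y - p) \<le> f y"
proof -
  have "convex ({p} \<times> {..<f p})" "convex (epigraph U f)"
    using assms by (auto intro: convex_Times convex_epigraphI)
  moreover have "({p} \<times> {..<f p}) \<inter> epigraph U f = {}" "epigraph U f \<noteq> {}" "{p} \<times> {..<f p} \<noteq> {}"
    using assms(3) by (auto simp: epigraph_def)
  ultimately obtain w b where w: "w \<noteq> 0"
    and lo: "\<forall>z\<in>{p} \<times> {..<f p}. w \<bullet> z \<le> b" and hi: "\<forall>z\<in>epigraph U f. b \<le> w \<bullet> z"
    using separating_hyperplane_sets[of "{p} \<times> {..<f p}" "epigraph U f"] by blast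
  obtain a r where ar: "w = (a, r)" by (cases w)
  have lo': "a \<bullet> p + r * s \<le> b" if "s < f p" for s
    using lo that by (auto simp: ar)
  have hi': "b \<le> a \<bullet> y + r * f y" if "y \<in> U" for y
    using hi that by (auto simp: ar epigraph_def)
  have "a \<bullet> p + r * (f p - 1) \<le> a \<bullet> p + r * f p"
    using lo'[of "f p - 1"] hi'[OF assms(3)] by simp
  then have "r \<ge> 0" by (simp add: algebra_simps)
  \<comment> \<open>The ray omits its endpoint, which lies in the epigraph; letting s tend to
    \<open>f p\<close> from the left recovers the inequality there.\<close>
  have lim: "a \<bullet> p + r * f p \<le> b"
  proof (rule tendsto_upperbound)
    show "((\<lambda>s. a \<bullet> p + r * s) \<longlongrightarrow> a \<bullet> p + r * f p) (at_left (f p))"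
      by (intro tendsto_intros)
    show "\<forall>\<^sub>F s in at_left (f p). a \<bullet> p + r * s \<le> b"
      using lo' by (auto simp: eventually_at_filter)
  qed simp
  have supp: "a \<bullet> p + r * f p \<le> a \<bullet> y + r * f y" if "y \<in> U" for y
    using lim hi'[OF that] by linarith
  \<comment> \<open>A vertical hyperplane would make \<open>p\<close> minimise the functional
    \<open>a\<close> over \<open>U\<close>. As \<open>U\<close> is open, a step of length
    \<open>e / 2\<close> from \<open>p\<close> against \<open>a\<close> stays in \<open>U\<close>
    and decreases it.\<close>
  have "r \<noteq> 0"
  proof
    assume "r = 0"
    then have "a \<noteq> 0" using w ar by (auto simp: zero_prod_def)
    obtain e where "e > 0" and e: "ball p e \<subseteq> U"
      using assms(1,3) open_contains_ball by blast
    define y where "y = p - (e / (2 * norm a)) *\<^sub>R a"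
    have "y \<in> U"
      using e \<open>e > 0\<close> \<open>a \<noteq> 0\<close> by (auto simp: y_def subset_iff dist_norm)
    then have "(e / (2 * norm a)) * (a \<bullet> a) \<le> 0"
      using supp[of y] \<open>r = 0\<close> by (simp add: y_def inner_diff_right)
    moreover have "(e / (2 * norm a)) * (a \<bullet> a) > 0"
      using \<open>e > 0\<close> \<open>a \<noteq> 0\<close> by simp
    ultimately show False by linarith
  qed
  with \<open>r \<ge> 0\<close> have "r > 0" by simp
  show thesis
  proof (rule that[of "- (a /\<^sub>R r)"])
    fix y assume "y \<in> U"
    from supp[OF this] \<open>r > 0\<close> show "f p + (- (a /\<^sub>R r)) \<bullet> (y - p) \<le> f y"
      by (simp add: inner_diff_right field_simps)
  qed
qed

text \<open>Both sides say that \<open>dim (A \<union> B)\<close> equals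
  \<open>card A + card B\<close>: the dimension formula for sums measures the defect by the
  intersection of the spans. Disjointness is demanded because independence of a family forbids
  repeated vectors.\<close>

lemma disjoint_independent_Un_iff:
  fixes A B :: "'a::euclidean_space set"
  assumes "independent A" and "independent B"
  shows "A \<inter> B = {} \<and> independent (A \<union> B) \<longleftrightarrow> span A \<inter> span B = {0}"
proof -
  have fin: "finite A" "finite B"
    using assms independent_imp_finite by auto
  have "dim {u + v |u v. u \<in> span A \<and> v \<in> span B} + dim (span A \<inter> span B) = dim (span A) + dim (span B)"
    by (intro dim_sums_Int subspace_span)
  then have dims: "dim (A \<union> B) + dim (span A \<inter> span B) = card A + card B"
    by (simp only: span_Un[symmetric] dim_span assms[THEN dim_eq_card_independent])
  have cards: "card A + card B = card (A \<union> B) + card (A \<inter> B)"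
    using fin by (rule card_Un_Int)
  have zero: "0 \<in> span A \<inter> span B"
    by (simp add: span_0)
  show ?thesis
  proof
    assume "A \<inter> B = {} \<and> independent (A \<union> B)"
    then have "dim (span A \<inter> span B) = 0"
      using dims cards dim_eq_card_independent[of "A \<union> B"] by simp
    then show "span A \<inter> span B = {0}"
      using zero by auto
  next
    assume "span A \<inter> span B = {0}"
    then have d: "dim (A \<union> B) = card A + card B"
      using dims by simp
    \<comment> \<open>A spanning set with no more elements than the dimension is independent; the
      exact count then leaves no room for common elements.\<close>
    then have "independent (A \<union> B)"
      using cards fin by (intro card_le_dim_spanning[of _ "A \<union> B"]) (auto intro: span_base)
    moreover from this have "card (A \<inter> B) = 0"
      using d cards dim_eq_card_independent[of "A \<union> B"] by simp
    ultimately show "A \<inter> B = {} \<and> independent (A \<union> B)"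
      using fin by simp
  qed
qed

lemma span_axis_eq:
  fixes F :: "'e::finite set"
  shows "span ((\<lambda>e. axis e 1 :: real ^ 'e) ` F) = {v. \<forall>e. e \<notin> F \<longrightarrow> v $ e = 0}"
proof -
  have "(\<lambda>e. axis e 1 :: real ^ 'e) ` F \<subseteq> Basis"
    by auto
  from span_substd_basis[OF this] show ?thesis
    by (auto simp: Basis_vec_def axis_eq_axis image_iff inner_axis)
qed

text \<open>A point of \<open>X\<close> outside the hull of \<open>B\<close> could be added to
  \<open>B\<close> without losing affine independence, against maximality.\<close>

lemma affine_basis_of_affine_hull:
  assumes "affine_basis_of B X"
  shows "affine hull B = affine hull X"
proof
  show "affine hull B \<subseteq> affine hull X"
    using assms by (intro hull_mono) (simp add: affine_basis_of_def)
  have "y \<in> affine hull B" if "y \<in> X" for y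
  proof (rule ccontr)
    assume y: "y \<notin> affine hull B"
    then have "insert y B = B"
      using assms that affine_independent_insert[of B y] unfolding affine_basis_of_def
      by (metis insert_subset subset_insertI)
    then show False using y hull_inc[of y B] by auto
  qed
  then show "affine hull X \<subseteq> affine hull B"
    by (intro hull_minimal) auto
qed

lemma affine_basis_of_differences:
  fixes x :: "nat \<Rightarrow> real ^ 'e::finite"
  assumes "inj_on x {0..k}" and "affine_basis_of (x ` {0..k}) X"
  defines "D \<equiv> (\<lambda>i. x i - x 0) ` {1..k}"
  shows "independent D" and "affine hull X = (+) (x 0) ` span D"
proof -
  have "{0..k} - {0} = {1..k}" by auto
  \<comment> \<open>By injectivity, \<open>x 0\<close> does not recur among the later points, so
    removing it removes exactly the index 0.\<close>
  then have "x ` {0..k} - {x 0} = x ` {1..k}"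
    using inj_on_image_set_diff[OF assms(1), of "{0..k}" "{0}"] by simp
  then have D: "(+) (- x 0) ` (x ` {0..k} - {x 0}) = D"
    by (simp add: D_def image_image)
  show "independent D"
    using assms(2) affine_dependent_iff_dependent2[of "x 0" "x ` {0..k}"]
    unfolding D affine_basis_of_def by simp
  show "affine hull X = (+) (x 0) ` span D"
    using affine_hull_span2[of "x 0" "x ` {0..k}"] affine_basis_of_affine_hull[OF assms(2)]
    unfolding D by simp
qed

lemma diff_mem_directions:
  fixes a y z :: "'a::real_vector"
  assumes "affine hull X = (+) a ` V" and "subspace V" and "y \<in> X" and "z \<in> X"
  shows "y - z \<in> V"
proof -
  obtain u u' where "u \<in> V" "u' \<in> V" "y = a + u" "z = a + u'"
    using assms hull_inc[of y X affine] hull_inc[of z X affine] by auto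
  then show ?thesis using assms(2) by (simp add: subspace_diff)
qed

lemma identifying_iff_directions:
  fixes X :: "(real ^ 'e::finite) set"
  assumes "X \<noteq> {}" and "convex X" and hull: "affine hull X = (+) a ` V" and V: "subspace V"
  shows "identifying S X \<longleftrightarrow> (\<forall>v\<in>V. (\<forall>e\<in>S. v $ e = 0) \<longrightarrow> v = 0)"
proof
  assume ident: "identifying S X"
  \<comment> \<open>Convexity enters here: it supplies a relative interior point. The ball lies in
    \<open>X\<close> only within the affine hull, so the shifted point must be shown to stay in that
    hull.\<close>
  obtain p r where p: "p \<in> X" and "r > 0" and r: "ball p r \<inter> affine hull X \<subseteq> X"
    using assms(1,2) rel_interior_eq_empty[of X] mem_rel_interior_ball[of _ X] by blast
  show "\<forall>v\<in>V. (\<forall>e\<in>S. v $ e = 0) \<longrightarrow> v = 0"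
  proof (intro ballI impI, rule ccontr)
    fix v assume v: "v \<in> V" "\<forall>e\<in>S. v $ e = 0" "v \<noteq> 0"
    \<comment> \<open>This puts the shifted point at distance \<open>r / 2\<close> from
      \<open>p\<close>.\<close>
    define t where "t = r / (2 * norm v)"
    have t: "t > 0" using \<open>r > 0\<close> v by (simp add: t_def)
    obtain u where u: "u \<in> V" "p = a + u"
      using hull_inc[OF p, of affine] hull by auto
    have "p + t *\<^sub>R v = a + (u + t *\<^sub>R v)" "u + t *\<^sub>R v \<in> V"
      using u v V by (auto simp: subspace_add subspace_scale)
    then have "p + t *\<^sub>R v \<in> affine hull X"
      unfolding hull by blast
    moreover have "p + t *\<^sub>R v \<in> ball p r"
      using \<open>r > 0\<close> v by (simp add: dist_norm t_def)
    ultimately have "p + t *\<^sub>R v \<in> X" using r by blast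
    moreover have "p + t *\<^sub>R v \<noteq> p" using t v by simp
    ultimately show False
      using ident p v(2) unfolding identifying_def by fastforce
  qed
next
  assume inj: "\<forall>v\<in>V. (\<forall>e\<in>S. v $ e = 0) \<longrightarrow> v = 0"
  show "identifying S X"
    unfolding identifying_def
  proof (intro ballI impI, rule ccontr)
    fix y z assume yz: "y \<in> X" "z \<in> X" "y \<noteq> z" "\<not> (\<exists>e\<in>S. y $ e \<noteq> z $ e)"
    then have "y - z = 0"
      using inj diff_mem_directions[OF hull V yz(1,2)] by (metis vector_minus_component eq_iff_diff_eq_0)
    with yz(3) show False by simp
  qed
qed

text \<open>The projection \<pi> to the coordinates in \<open>S\<close> is injective on
  \<open>V\<close>, hence has a linear left inverse \<open>h\<close> there. The functional
  \<open>g\<close> after \<open>h\<close> after \<pi> agrees with \<open>g\<close> on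
  \<open>V\<close> and reads only coordinates in \<open>S\<close>; its coefficients are its values
  on the unit vectors.\<close>

lemma functional_supported_on_coordinates:
  fixes g :: "real ^ 'e::finite"
  assumes V: "subspace V" and inj: "\<And>v. v \<in> V \<Longrightarrow> (\<And>e. e \<in> S \<Longrightarrow> v $ e = 0) \<Longrightarrow> v = 0"
  obtains \<gamma> :: "'e \<Rightarrow> real" where "\<And>v. v \<in> V \<Longrightarrow> (\<Sum>e\<in>S. \<gamma> e * v $ e) = g \<bullet> v"
proof -
  define \<pi> :: "real ^ 'e \<Rightarrow> real ^ 'e" where "\<pi> v = (\<Sum>e\<in>S. v $ e *\<^sub>R axis e 1)" for v
  have \<pi>_nth: "\<pi> v $ e = (if e \<in> S then v $ e else 0)" for v e
    by (simp add: \<pi>_def axis_def if_distrib cong: if_cong)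
  have lin: "linear \<pi>"
    by (rule linearI) (simp_all add: vec_eq_iff \<pi>_nth)
  have "inj_on \<pi> V"
  proof (rule inj_onI)
    fix u v assume "u \<in> V" "v \<in> V" "\<pi> u = \<pi> v"
    then have "u - v = 0"
      using V by (intro inj) (auto simp: subspace_diff vec_eq_iff \<pi>_nth split: if_splits)
    then show "u = v" by simp
  qed
  then obtain h where h: "linear h" "\<And>v. v \<in> V \<Longrightarrow> h (\<pi> v) = v"
    using linear_exists_left_inverse_on[OF lin V] by blast
  show thesis
  proof (rule that[of "\<lambda>e. g \<bullet> h (axis e 1)"])
    fix v assume "v \<in> V"
    then have "g \<bullet> v = g \<bullet> h (\<pi> v)" by (simp add: h)
    also have "\<dots> = (\<Sum>e\<in>S. g \<bullet> h (axis e 1) * v $ e)"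
      by (simp add: \<pi>_def linear_sum[OF h(1)] linear_scale[OF h(1)] inner_sum_right mult.commute)
    finally show "(\<Sum>e\<in>S. g \<bullet> h (axis e 1) * v $ e) = g \<bullet> v" ..
  qed
qed

lemma controlling_imp_identifying:
  fixes X :: "(real ^ 'e::finite) set"
  assumes "controlling S X (convex_costs X)"
  shows "identifying S X"
  unfolding identifying_def
proof (intro ballI impI, rule ccontr)
  fix y z assume yz: "y \<in> X" "z \<in> X" "y \<noteq> z" "\<not> (\<exists>e\<in>S. y $ e \<noteq> z $ e)"
  \<comment> \<open>This cost is larger at \<open>y\<close> than at \<open>z\<close> by the squared
    norm of \<open>y - z\<close>, while any \<gamma>-term is the same at both, so \<open>y\<close>
    cannot be made a minimiser.\<close>
  let ?c = "\<lambda>w. (y - z) \<bullet> w"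
  have "convex_on UNIV ?c"
    by (auto simp: convex_on_def inner_add_right)
  then have "?c \<in> convex_costs X"
    unfolding convex_costs_def by blast
  then obtain \<gamma> :: "'e \<Rightarrow> real" where
      "is_arg_min (\<lambda>w. ?c w + (\<Sum>e\<in>S. \<gamma> e * w $ e)) (\<lambda>w. w \<in> X) y"
    using assms yz(1) unfolding controlling_def by blast
  then have "?c y + (\<Sum>e\<in>S. \<gamma> e * y $ e) \<le> ?c z + (\<Sum>e\<in>S. \<gamma> e * z $ e)"
    using yz(2) by (auto simp: is_arg_min_def not_less)
  moreover have "(\<Sum>e\<in>S. \<gamma> e * y $ e) = (\<Sum>e\<in>S. \<gamma> e * z $ e)"
    using yz(4) by (intro sum.cong) auto
  ultimately have "(y - z) \<bullet> (y - z) \<le> 0"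
    by (simp add: inner_diff_right)
  moreover have "(y - z) \<bullet> (y - z) > 0"
    using yz(3) by simp
  ultimately show False by linarith
qed

lemma controlling_if_directions:
  fixes X :: "(real ^ 'e::finite) set"
  assumes "subspace V" and diff: "\<And>y z. y \<in> X \<Longrightarrow> z \<in> X \<Longrightarrow> y - z \<in> V"
    and inj: "\<And>v. v \<in> V \<Longrightarrow> (\<And>e. e \<in> S \<Longrightarrow> v $ e = 0) \<Longrightarrow> v = 0"
  shows "controlling S X (convex_costs X)"
  unfolding controlling_def
proof (intro ballI)
  fix c p assume c: "c \<in> convex_costs X" and p: "p \<in> X"
  obtain U f where U: "open U" "X \<subseteq> U" "convex_on U f" and cf: "\<forall>y\<in>X. c y = f y"
    using c unfolding convex_costs_def by blast
  \<comment> \<open>Even if \<open>p\<close> is a relative boundary point of \<open>X\<close>, it is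
    interior to \<open>U\<close>, so a subgradient exists.\<close>
  obtain g where g: "\<And>y. y \<in> U \<Longrightarrow> f p + g \<bullet> (y - p) \<le> f y"
    using convex_on_open_subgradient[of U f p] U p by blast
  \<comment> \<open>The negative sign lets the \<gamma>-term cancel the slope of the supporting
    affine function at \<open>p\<close>.\<close>
  obtain \<gamma> :: "'e \<Rightarrow> real" where \<gamma>: "\<And>v. v \<in> V \<Longrightarrow> (\<Sum>e\<in>S. \<gamma> e * v $ e) = (- g) \<bullet> v"
    using functional_supported_on_coordinates[OF assms(1) inj] by blast
  have "c p + (\<Sum>e\<in>S. \<gamma> e * p $ e) \<le> c y + (\<Sum>e\<in>S. \<gamma> e * y $ e)" if y: "y \<in> X" for y
  proof -
    have "(\<Sum>e\<in>S. \<gamma> e * y $ e) - (\<Sum>e\<in>S. \<gamma> e * p $ e) = - (g \<bullet> (y - p))"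
      using \<gamma>[OF diff[OF y p]] by (simp add: sum_subtractf right_diff_distrib)
    then show ?thesis
      using g[of y] y U(2) cf p by auto
  qed
  then have "is_arg_min (\<lambda>y. c y + (\<Sum>e\<in>S. \<gamma> e * y $ e)) (\<lambda>y. y \<in> X) p"
    using p by (auto simp: is_arg_min_def not_less)
  then show "\<exists>\<gamma> :: 'e \<Rightarrow> real. is_arg_min (\<lambda>y. c y + (\<Sum>e\<in>S. \<gamma> e * y $ e)) (\<lambda>y. y \<in> X) p"
    by (rule exI[where x = \<gamma>])
qed

text \<open>The differences and the unit vectors are each independent without repetition, so the
  family is independent exactly when the two image sets are disjoint with independent union, that
  is, when their spans meet trivially.\<close>

lemma A_indep_iff:
  fixes x :: "nat \<Rightarrow> real ^ 'e::finite"
  assumes inj: "inj_on x {0..k}"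
  defines "D \<equiv> (\<lambda>i. x i - x 0) ` {1..k}"
  assumes D: "independent D"
  shows "F \<in> A_indep x k \<longleftrightarrow> span D \<inter> {v. \<forall>e. e \<notin> F \<longrightarrow> v $ e = 0} = {0}"
proof -
  let ?ax = "\<lambda>e. axis e 1 :: real ^ 'e"
  have "?ax ` F \<subseteq> Basis"
    by auto
  then have ax: "independent (?ax ` F)"
    using independent_Basis independent_mono by blast
  have image: "A_vec x ` A_index k F = D \<union> ?ax ` F"
    by (simp add: A_vec_def A_index_def D_def Plus_def image_Un image_image)
  have "inj_on (A_vec x) (Inl ` {1..k})" "inj_on (A_vec x) (Inr ` F)"
    using inj by (auto simp: inj_on_def axis_eq_axis A_vec_def)
  moreover have "Inl ` {1..k} - Inr ` F = Inl ` {1..k}" "Inr ` F - Inl ` {1..k} = Inr ` F"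
    by auto
  moreover have "A_vec x ` Inl ` {1..k} = D" "A_vec x ` Inr ` F = ?ax ` F"
    by (simp_all add: A_vec_def D_def image_image)
  ultimately have "inj_on (A_vec x) (A_index k F) \<longleftrightarrow> D \<inter> ?ax ` F = {}"
    unfolding A_index_def Plus_def inj_on_Un by simp
  then show ?thesis
    using disjoint_independent_Un_iff[OF D ax]
    by (simp add: A_indep_def independent_family_def image span_axis_eq)
qed

theorem theorem3p2:
  fixes X :: "(real ^ 'e::finite) set" and S :: "'e set"
    and x :: "nat \<Rightarrow> real ^ 'e" and k :: nat
  assumes "X \<noteq> {}" and "convex X"
    and "inj_on x {0..k}" and "affine_basis_of (x ` {0..k}) X"
  shows "(controlling S X (convex_costs X) \<longleftrightarrow> identifying S X) \<and>
         (identifying S X \<longleftrightarrow> UNIV - S \<in> A_indep x k)"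
proof -
  define V where "V = span ((\<lambda>i. x i - x 0) ` {1..k})"
  note basis = affine_basis_of_differences[OF assms(3,4)]
  have V: "subspace V" by (simp add: V_def)
  have hull: "affine hull X = (+) (x 0) ` V"
    using basis(2) by (simp add: V_def)
  have ident: "identifying S X \<longleftrightarrow> (\<forall>v\<in>V. (\<forall>e\<in>S. v $ e = 0) \<longrightarrow> v = 0)"
    by (rule identifying_iff_directions[OF assms(1,2) hull V])
  note diff = diff_mem_directions[OF hull V]
  have "controlling S X (convex_costs X)" if "identifying S X"
  proof (rule controlling_if_directions[OF V diff])
    show "v = 0" if "v \<in> V" "\<And>e. e \<in> S \<Longrightarrow> v $ e = 0" for v
      using that \<open>identifying S X\<close> ident by blast
  qed
  \<comment> \<open>Vanishing outside the complement of \<open>S\<close> is vanishing on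
    \<open>S\<close>.\<close>
  moreover have "UNIV - S \<in> A_indep x k \<longleftrightarrow> V \<inter> {v. \<forall>e\<in>S. v $ e = 0} = {0}"
    using A_indep_iff[OF assms(3) basis(1), of "UNIV - S"] by (simp add: V_def Ball_def)
  moreover have "0 \<in> V" using V by (rule subspace_0)
  ultimately show ?thesis
    using ident controlling_imp_identifying[of S X] by auto
qed

end
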